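(* Let $\bigl(((A,\circ_A),P_A),((\mathfrak b,\circ_{\mathfrak b}),P_{\mathfrak b}),\rho_A,\varphi_A,\rho_{\mathfrak b},\varphi_{\mathfrak b}\bigr)$ be a matched pair of averaging pre-Lie algebras, and let $A_{P_A}$, $\mathfrak b_{P_{\mathfrak b}}$ be the induced Leibniz algebras. For $x\in A$, $\xi\in\mathfrak b$ put $$\rho^L(x)\xi=\rho_A(P_A(x))\xi-\varphi_A(P_A(x))\xi,\qquad \rho^R(x)\xi=-\rho_A(x)(P_{\mathfrak b}\xi)+\varphi_A(x)(P_{\mathfrak b}\xi),$$ $$\mu^L(\xi)x=\rho_{\mathfrak b}(P_{\mathfrak b}(\xi))x-\varphi_{\mathfrak b}(P_{\mathfrak b}(\xi))x,\qquad \mu^R(\xi)x=-\rho_{\mathfrak b}(\xi)(P_Ax)+\varphi_{\mathfrak b}(\xi)(P_Ax).$$ Then $(A_{P_A},\mathfrak b_{P_{\mathfrak b}};(\rho^L,\rho^R),(\mu^L,\mu^R))$ is a matched pair of Leibniz algebras. Moreover, $A_{P_A}\bowtie\mathfrak b_{P_{\mathfrak b}}=(A\bowtie\mathfrak b)_{P_A\oplus P_{\mathfrak b}}$ as Leibniz algebras.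
   Context: All vector spaces are finite-dimensional over a fixed field $\mathbf k$ of characteristic $0$. A pre-Lie algebra $(A,\circ)$ is a vector space with a bilinear product satisfying $(x\circ y)\circ z-x\circ(y\circ z)=(y\circ x)\circ z-y\circ(x\circ z)$. An averaging operator is a linear $P:A\to A$ with $P(x)\circ P(y)=P(P(x)\circ y)=P(x\circ P(y))$; then $((A,\circ),P)$ is an averaging pre-Lie algebra. Its induced Leibniz algebra $A_P$ is the space $A$ with bracket $[x,y]_P=P(x)\circ y-y\circ P(x)$. Here a (left) Leibniz algebra $(\mathcal G,[\cdot,\cdot])$ satisfies $[[x,y],z]+[y,[x,z]]=[x,[y,z]]$. A representation of $(A,\circ)$ is $(V,\rho,\varphi)$ with linear $\rho,\varphi:A\to\mathrm{End}(V)$ such that $\rho(x\circ y-y\circ x)=\rho(x)\rho(y)-\rho(y)\rho(x)$ and $\varphi(x\circ y)=\rho(x)\varphi(y)-\varphi(y)\rho(x)+\varphi(y)\varphi(x)$. A representation of $((A,\circ),P)$ is $((V,\rho,\varphi),\alpha)$ with $(V,\rho,\varphi)$ a representation of $(A,\circ)$ and $\alpha:V\to V$ linear such that $\rho(P(x))\alpha(v)=\alpha(\rho(P(x))v)=\alpha(\rho(x)\alpha(v))$ and $\varphi(P(x))\alpha(v)=\alpha(\varphi(P(x))v)=\alpha(\varphi(x)\alpha(v))$. A matched pair of averaging pre-Lie algebras is a sextuple $(((A,\circ_A),P_A),((\mathfrak b,\circ_{\mathfrak b}),P_{\mathfrak b}),\rho_A,\varphi_A,\rho_{\mathfrak b},\varphi_{\mathfrak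 b})$ where the first two entries are averaging pre-Lie algebras, $((\mathfrak b,\rho_A,\varphi_A),P_{\mathfrak b})$ is a representation of $((A,\circ_A),P_A)$, $((A,\rho_{\mathfrak b},\varphi_{\mathfrak b}),P_A)$ is a representation of $((\mathfrak b,\circ_{\mathfrak b}),P_{\mathfrak b})$, and for all $x,y\in A$, $a,b\in\mathfrak b$: $\rho_A(x)(a\circ_{\mathfrak b}b)=-\rho_A(\rho_{\mathfrak b}(a)x-\varphi_{\mathfrak b}(a)x)b+(\rho_A(x)a-\varphi_A(x)a)\circ_{\mathfrak b}b+\varphi_A(\varphi_{\mathfrak b}(b)x)a+a\circ_{\mathfrak b}(\rho_A(x)b)$, $\varphi_A(x)(a\circ_{\mathfrak b}b-b\circ_{\mathfrak b}a)=\varphi_A(\rho_{\mathfrak b}(b)x)a-\varphi_A(\rho_{\mathfrak b}(a)x)b+a\circ_{\mathfrak b}(\varphi_A(x)b)-b\circ_{\mathfrak b}(\varphi_A(x)a)$, $\rho_{\mathfrak b}(a)(x\circ_Ay)=-\rho_{\mathfrak b}(\rho_A(x)a-\varphi_A(x)a)y+(\rho_{\mathfrak b}(a)x-\varphi_{\mathfrak b}(a)x)\circ_Ay+\varphi_{\mathfrak b}(\varphi_A(y)a)x+x\circ_A(\rho_{\mathfrak b}(a)y)$, $\varphi_{\mathfrak b}(a)(x\circ_Ay-y\circ_Ax)=\varphi_{\mathfrak b}(\rho_A(y)a)x-\varphi_{\mathfrak b}(\rho_A(x)a)y+x\circ_A(\varphi_{\mathfrak b}(a)y)-y\circ_A(\varphi_{\mathfrak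 b}(a)x)$. In this case $(A\bowtie\mathfrak b,P_A\oplus P_{\mathfrak b})$ denotes the averaging pre-Lie algebra on $A\oplus\mathfrak b$ with product $(x+a)\circ_\star(y+b)=x\circ_Ay+\rho_{\mathfrak b}(a)y+\varphi_{\mathfrak b}(b)x+a\circ_{\mathfrak b}b+\rho_A(x)b+\varphi_A(y)a$ and operator $x+a\mapsto P_A(x)+P_{\mathfrak b}(a)$; $(A\bowtie\mathfrak b)_{P_A\oplus P_{\mathfrak b}}$ is its induced Leibniz algebra. A representation of a Leibniz algebra $(\mathcal G,[\cdot,\cdot]_{\mathcal G})$ is $(W;\rho^L,\rho^R)$ with linear $\rho^L,\rho^R:\mathcal G\to\mathfrak{gl}(W)$ such that $\rho^L([x,y])=\rho^L(x)\rho^L(y)-\rho^L(y)\rho^L(x)$, $\rho^R([x,y])=\rho^L(x)\rho^R(y)-\rho^R(y)\rho^L(x)$, $\rho^R(y)\rho^L(x)=-\rho^R(y)\rho^R(x)$. A matched pair of Leibniz algebras $(\mathcal G_1,\mathcal G_2;(\rho^L,\rho^R),(\mu^L,\mu^R))$ consists of Leibniz algebras $\mathcal G_1,\mathcal G_2$, a representation $(\mathcal G_2;\rho^L,\rho^R)$ of $\mathcal G_1$ and a representation $(\mathcal G_1;\mu^L,\mu^R)$ of $\mathcal G_2$ such that for all $x,y\in\mathcal G_1$, $\xi,\eta\in\mathcal G_2$: $\rho^R(x)[\xi,\eta]-[\xi,\rho^R(x)\eta]+[\eta,\rho^R(x)\xi]-\rho^R(\mu^L(\eta)x)\xi+\rho^R(\mu^L(\xi)x)\eta=0$,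 $\rho^L(x)[\xi,\eta]-[\rho^L(x)\xi,\eta]-[\xi,\rho^L(x)\eta]-\rho^L(\mu^R(\xi)x)\eta-\rho^R(\mu^R(\eta)x)\xi=0$, $[\rho^L(x)\xi,\eta]+\rho^L(\mu^R(\xi)x)\eta+[\rho^R(x)\xi,\eta]+\rho^L(\mu^L(\xi)x)\eta=0$, $\mu^R(\xi)[x,y]-[x,\mu^R(\xi)y]+[y,\mu^R(\xi)x]-\mu^R(\rho^L(y)\xi)x+\mu^R(\rho^L(x)\xi)y=0$, $\mu^L(\xi)[x,y]-[\mu^L(\xi)x,y]-[x,\mu^L(\xi)y]-\mu^L(\rho^R(x)\xi)y-\mu^R(\rho^R(y)\xi)x=0$, $[\mu^L(\xi)x,y]+\mu^L(\rho^R(x)\xi)y+[\mu^R(\xi)x,y]+\mu^L(\rho^L(x)\xi)y=0$. Then $\mathcal G_1\bowtie\mathcal G_2$ denotes the Leibniz algebra $\mathcal G_1\oplus\mathcal G_2$ with bracket $[x+\xi,y+\eta]=[x,y]_{\mathcal G_1}+\mu^L(\xi)y+\mu^R(\eta)x+[\xi,\eta]_{\mathcal G_2}+\rho^L(x)\eta+\rho^R(y)\xi$. *)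

theory Defs
  imports "HOL-Analysis.Product_Vector"
begin

text \<open>
  Vector spaces over a field of characteristic 0 are types of class \<^class>\<open>ab_group_add\<close>
  together with a scalar multiplication satisfying \<^locale>\<open>vector_space\<close>. A linear map
  from \<open>U\<close> to \<open>End(V)\<close> is a map \<open>f :: 'u \<Rightarrow> 'v \<Rightarrow> 'v\<close> that is bilinear in the sense of the locale
  \<open>bilinear_map\<close> below: linearity in the second argument says that every \<open>f x\<close> is an endomorphism,
  and linearity in the first argument says that \<open>x \<mapsto> f x\<close> is linear.
\<close>

definition finite_dim :: "('k::field_char_0 \<Rightarrow> 'v::ab_group_add \<Rightarrow> 'v) \<Rightarrow> bool" where
  "finite_dim s \<longleftrightarrow> (\<exists>B. finite_dimensional_vector_space s B)"

locale bilinear_map =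
  fixes s1 :: "'k::field_char_0 \<Rightarrow> 'u::ab_group_add \<Rightarrow> 'u"
    and s2 :: "'k \<Rightarrow> 'v::ab_group_add \<Rightarrow> 'v"
    and s3 :: "'k \<Rightarrow> 'w::ab_group_add \<Rightarrow> 'w"
    and f :: "'u \<Rightarrow> 'v \<Rightarrow> 'w"
  assumes linear_left: "Vector_Spaces.linear s1 s3 (\<lambda>x. f x y)"
    and linear_right: "Vector_Spaces.linear s2 s3 (f x)"

section \<open>Averaging pre-Lie algebras\<close>

locale pre_lie_algebra =
  fixes s :: "'k::field_char_0 \<Rightarrow> 'a::ab_group_add \<Rightarrow> 'a"
    and mult :: "'a \<Rightarrow> 'a \<Rightarrow> 'a" (infixl "\<circ>\<^sub>\<bullet>" 70)
  assumes finite_dim: "finite_dim s"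
    and bilinear: "bilinear_map s s s (\<circ>\<^sub>\<bullet>)"
    and pre_lie:
      "(x \<circ>\<^sub>\<bullet> y) \<circ>\<^sub>\<bullet> z - x \<circ>\<^sub>\<bullet> (y \<circ>\<^sub>\<bullet> z) = (y \<circ>\<^sub>\<bullet> x) \<circ>\<^sub>\<bullet> z - y \<circ>\<^sub>\<bullet> (x \<circ>\<^sub>\<bullet> z)"

locale averaging_pre_lie_algebra = pre_lie_algebra s mult
  for s :: "'k::field_char_0 \<Rightarrow> 'a::ab_group_add \<Rightarrow> 'a"
    and mult :: "'a \<Rightarrow> 'a \<Rightarrow> 'a" (infixl "\<circ>\<^sub>\<bullet>" 70) +
  fixes P :: "'a \<Rightarrow> 'a"
  assumes linear_P: "Vector_Spaces.linear s s P"
    and averaging_left: "P x \<circ>\<^sub>\<bullet> P y = P (P x \<circ>\<^sub>\<bullet> y)"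
    and averaging_right: "P x \<circ>\<^sub>\<bullet> P y = P (x \<circ>\<^sub>\<bullet> P y)"

locale pre_lie_representation = pre_lie_algebra s mult
  for s :: "'k::field_char_0 \<Rightarrow> 'a::ab_group_add \<Rightarrow> 'a"
    and mult :: "'a \<Rightarrow> 'a \<Rightarrow> 'a" (infixl "\<circ>\<^sub>\<bullet>" 70) +
  fixes sV :: "'k \<Rightarrow> 'v::ab_group_add \<Rightarrow> 'v"
    and \<rho> \<phi> :: "'a \<Rightarrow> 'v \<Rightarrow> 'v"
  assumes finite_dim_V: "finite_dim sV"
    and bilinear_rho: "bilinear_map s sV sV \<rho>"
    and bilinear_phi: "bilinear_map s sV sV \<phi>"
    and rho_commutator: "\<rho> (x \<circ>\<^sub>\<bullet> y - y \<circ>\<^sub>\<bullet> x) v = \<rho> x (\<rho> y v) - \<rho> y (\<rho> x v)"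
    and phi_mult: "\<phi> (x \<circ>\<^sub>\<bullet> y) v = \<rho> x (\<phi> y v) - \<phi> y (\<rho> x v) + \<phi> y (\<phi> x v)"

locale averaging_pre_lie_representation =
  averaging_pre_lie_algebra s mult P + pre_lie_representation s mult sV \<rho> \<phi>
  for s :: "'k::field_char_0 \<Rightarrow> 'a::ab_group_add \<Rightarrow> 'a"
    and mult :: "'a \<Rightarrow> 'a \<Rightarrow> 'a" (infixl "\<circ>\<^sub>\<bullet>" 70)
    and P :: "'a \<Rightarrow> 'a"
    and sV :: "'k \<Rightarrow> 'v::ab_group_add \<Rightarrow> 'v"
    and \<rho> \<phi> :: "'a \<Rightarrow> 'v \<Rightarrow> 'v" +
  fixes \<alpha> :: "'v \<Rightarrow> 'v"
  assumes linear_alpha: "Vector_Spaces.linear sV sV \<alpha>"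
    and rho_averaging_left: "\<rho> (P x) (\<alpha> v) = \<alpha> (\<rho> (P x) v)"
    and rho_averaging_right: "\<rho> (P x) (\<alpha> v) = \<alpha> (\<rho> x (\<alpha> v))"
    and phi_averaging_left: "\<phi> (P x) (\<alpha> v) = \<alpha> (\<phi> (P x) v)"
    and phi_averaging_right: "\<phi> (P x) (\<alpha> v) = \<alpha> (\<phi> x (\<alpha> v))"

locale averaging_pre_lie_matched_pair =
  A: averaging_pre_lie_algebra sA multA PA +
  B: averaging_pre_lie_algebra sB multB PB +
  rep_A: averaging_pre_lie_representation sA multA PA sB \<rho>A \<phi>A PB +
  rep_B: averaging_pre_lie_representation sB multB PB sA \<rho>B \<phi>B PA
  for sA :: "'k::field_char_0 \<Rightarrow> 'a::ab_group_add \<Rightarrow> 'a"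
    and multA :: "'a \<Rightarrow> 'a \<Rightarrow> 'a" (infixl "\<circ>\<^sub>A" 70)
    and PA :: "'a \<Rightarrow> 'a"
    and sB :: "'k \<Rightarrow> 'b::ab_group_add \<Rightarrow> 'b"
    and multB :: "'b \<Rightarrow> 'b \<Rightarrow> 'b" (infixl "\<circ>\<^sub>B" 70)
    and PB :: "'b \<Rightarrow> 'b"
    and \<rho>A \<phi>A :: "'a \<Rightarrow> 'b \<Rightarrow> 'b"
    and \<rho>B \<phi>B :: "'b \<Rightarrow> 'a \<Rightarrow> 'a" +
  assumes compat_rhoA:
      "\<rho>A x (a \<circ>\<^sub>B b) =
         - \<rho>A (\<rho>B a x - \<phi>B a x) b + (\<rho>A x a - \<phi>A x a) \<circ>\<^sub>B b + \<phi>A (\<phi>B b x) a + a \<circ>\<^sub>B \<rho>A x b"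
    and compat_phiA:
      "\<phi>A x (a \<circ>\<^sub>B b - b \<circ>\<^sub>B a) =
         \<phi>A (\<rho>B b x) a - \<phi>A (\<rho>B a x) b + a \<circ>\<^sub>B \<phi>A x b - b \<circ>\<^sub>B \<phi>A x a"
    and compat_rhoB:
      "\<rho>B a (x \<circ>\<^sub>A y) =
         - \<rho>B (\<rho>A x a - \<phi>A x a) y + (\<rho>B a x - \<phi>B a x) \<circ>\<^sub>A y + \<phi>B (\<phi>A y a) x + x \<circ>\<^sub>A \<rho>B a y"
    and compat_phiB:
      "\<phi>B a (x \<circ>\<^sub>A y - y \<circ>\<^sub>A x) =
         \<phi>B (\<rho>A y a) x - \<phi>B (\<rho>A x a) y + x \<circ>\<^sub>A \<phi>B a y - y \<circ>\<^sub>A \<phi>B a x"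

text \<open>
  The direct sum of two spaces is the product type, with scalar multiplication
  \<^const>\<open>module_prod.scale\<close>; the element \<open>x + a\<close> of the sum is the pair \<open>(x, a)\<close>.
\<close>

definition pre_lie_bicrossed ::
  "('a::ab_group_add \<Rightarrow> 'a \<Rightarrow> 'a) \<Rightarrow> ('b::ab_group_add \<Rightarrow> 'b \<Rightarrow> 'b) \<Rightarrow>
   ('a \<Rightarrow> 'b \<Rightarrow> 'b) \<Rightarrow> ('a \<Rightarrow> 'b \<Rightarrow> 'b) \<Rightarrow> ('b \<Rightarrow> 'a \<Rightarrow> 'a) \<Rightarrow> ('b \<Rightarrow> 'a \<Rightarrow> 'a) \<Rightarrow>
   'a \<times> 'b \<Rightarrow> 'a \<times> 'b \<Rightarrow> 'a \<times> 'b" where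
  "pre_lie_bicrossed multA multB \<rho>A \<phi>A \<rho>B \<phi>B = (\<lambda>(x, a) (y, b).
     (multA x y + \<rho>B a y + \<phi>B b x, multB a b + \<rho>A x b + \<phi>A y a))"

section \<open>Leibniz algebras\<close>

locale leibniz_algebra =
  fixes s :: "'k::field_char_0 \<Rightarrow> 'g::ab_group_add \<Rightarrow> 'g"
    and br :: "'g \<Rightarrow> 'g \<Rightarrow> 'g"
  assumes finite_dim: "finite_dim s"
    and bilinear: "bilinear_map s s s br"
    and leibniz: "br (br x y) z + br y (br x z) = br x (br y z)"

definition induced_bracket ::
  "('a::ab_group_add \<Rightarrow> 'a \<Rightarrow> 'a) \<Rightarrow> ('a \<Rightarrow> 'a) \<Rightarrow> 'a \<Rightarrow> 'a \<Rightarrow> 'a" where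
  "induced_bracket mult P x y = mult (P x) y - mult y (P x)"

locale leibniz_representation = leibniz_algebra s br
  for s :: "'k::field_char_0 \<Rightarrow> 'g::ab_group_add \<Rightarrow> 'g"
    and br :: "'g \<Rightarrow> 'g \<Rightarrow> 'g" +
  fixes sW :: "'k \<Rightarrow> 'w::ab_group_add \<Rightarrow> 'w"
    and \<rho>L \<rho>R :: "'g \<Rightarrow> 'w \<Rightarrow> 'w"
  assumes finite_dim_W: "finite_dim sW"
    and bilinear_L: "bilinear_map s sW sW \<rho>L"
    and bilinear_R: "bilinear_map s sW sW \<rho>R"
    and L_bracket: "\<rho>L (br x y) w = \<rho>L x (\<rho>L y w) - \<rho>L y (\<rho>L x w)"
    and R_bracket: "\<rho>R (br x y) w = \<rho>L x (\<rho>R y w) - \<rho>R y (\<rho>L x w)"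
    and R_L: "\<rho>R y (\<rho>L x w) = - \<rho>R y (\<rho>R x w)"

locale leibniz_matched_pair =
  G: leibniz_algebra sG brG +
  H: leibniz_algebra sH brH +
  rep_G: leibniz_representation sG brG sH \<rho>L \<rho>R +
  rep_H: leibniz_representation sH brH sG \<mu>L \<mu>R
  for sG :: "'k::field_char_0 \<Rightarrow> 'g::ab_group_add \<Rightarrow> 'g"
    and brG :: "'g \<Rightarrow> 'g \<Rightarrow> 'g"
    and sH :: "'k \<Rightarrow> 'h::ab_group_add \<Rightarrow> 'h"
    and brH :: "'h \<Rightarrow> 'h \<Rightarrow> 'h"
    and \<rho>L \<rho>R :: "'g \<Rightarrow> 'h \<Rightarrow> 'h"
    and \<mu>L \<mu>R :: "'h \<Rightarrow> 'g \<Rightarrow> 'g" +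
  assumes compat_G1:
      "\<rho>R x (brH \<xi> \<eta>) - brH \<xi> (\<rho>R x \<eta>) + brH \<eta> (\<rho>R x \<xi>)
         - \<rho>R (\<mu>L \<eta> x) \<xi> + \<rho>R (\<mu>L \<xi> x) \<eta> = 0"
    and compat_G2:
      "\<rho>L x (brH \<xi> \<eta>) - brH (\<rho>L x \<xi>) \<eta> - brH \<xi> (\<rho>L x \<eta>)
         - \<rho>L (\<mu>R \<xi> x) \<eta> - \<rho>R (\<mu>R \<eta> x) \<xi> = 0"
    and compat_G3:
      "brH (\<rho>L x \<xi>) \<eta> + \<rho>L (\<mu>R \<xi> x) \<eta> + brH (\<rho>R x \<xi>) \<eta> + \<rho>L (\<mu>L \<xi> x) \<eta> = 0"
    and compat_H1:
      "\<mu>R \<xi> (brG x y) - brG x (\<mu>R \<xi> y) + brG y (\<mu>R \<xi> x)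
         - \<mu>R (\<rho>L y \<xi>) x + \<mu>R (\<rho>L x \<xi>) y = 0"
    and compat_H2:
      "\<mu>L \<xi> (brG x y) - brG (\<mu>L \<xi> x) y - brG x (\<mu>L \<xi> y)
         - \<mu>L (\<rho>R x \<xi>) y - \<mu>R (\<rho>R y \<xi>) x = 0"
    and compat_H3:
      "brG (\<mu>L \<xi> x) y + \<mu>L (\<rho>R x \<xi>) y + brG (\<mu>R \<xi> x) y + \<mu>L (\<rho>L x \<xi>) y = 0"

definition leibniz_bicrossed ::
  "('g::ab_group_add \<Rightarrow> 'g \<Rightarrow> 'g) \<Rightarrow> ('h::ab_group_add \<Rightarrow> 'h \<Rightarrow> 'h) \<Rightarrow>
   ('g \<Rightarrow> 'h \<Rightarrow> 'h) \<Rightarrow> ('g \<Rightarrow> 'h \<Rightarrow> 'h) \<Rightarrow> ('h \<Rightarrow> 'g \<Rightarrow> 'g) \<Rightarrow> ('h \<Rightarrow> 'g \<Rightarrow> 'g) \<Rightarrow>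
   'g \<times> 'h \<Rightarrow> 'g \<times> 'h \<Rightarrow> 'g \<times> 'h" where
  "leibniz_bicrossed brG brH \<rho>L \<rho>R \<mu>L \<mu>R = (\<lambda>(x, \<xi>) (y, \<eta>).
     (brG x y + \<mu>L \<xi> y + \<mu>R \<eta> x, brH \<xi> \<eta> + \<rho>L x \<eta> + \<rho>R y \<xi>))"

end

theory Submission
  imports Defs
begin

text \<open>
  The induced bracket of any averaging pre-Lie algebra is a Leibniz bracket, and
  \<open>(A \<bowtie> \<bb>, P\<^sub>A \<oplus> P\<^sub>\<bb>)\<close> is an averaging pre-Lie algebra, so its induced bracket is
  Leibniz. Expanding the definitions shows that this bracket is the bicrossed bracket for
  \<open>(\<rho>\<^sup>L, \<rho>\<^sup>R), (\<mu>\<^sup>L, \<mu>\<^sup>R)\<close>. The representation and compatibility axioms of a matched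
  pair of Leibniz algebras are then the components, on mixed triples, of the Leibniz identity
  \<open>[[x,y],z] + [y,[x,z]] = [x,[y,z]]\<close> and of its consequence \<open>[[x,y] + [y,x], z] = 0\<close>.
\<close>

section \<open>Direct sums and bilinear maps\<close>

lemma finite_dim_vector_space: "finite_dim s \<Longrightarrow> vector_space s"
  unfolding finite_dim_def finite_dimensional_vector_space_def by blast

lemma finite_dim_prod:
  assumes "finite_dim s1" "finite_dim s2"
  shows "finite_dim (module_prod.scale s1 s2)"
proof -
  obtain B1 B2 where "finite_dimensional_vector_space s1 B1" "finite_dimensional_vector_space s2 B2"
    using assms unfolding finite_dim_def by blast
  then interpret finite_dimensional_vector_space_prod s1 s2 B1 B2
    by (simp add: finite_dimensional_vector_space_prod_def finite_dimensional_vector_space_pair_def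
        vector_space_prod_def vector_space_pair_def finite_dimensional_vector_space_def)
  show ?thesis
    unfolding finite_dim_def using p.finite_dimensional_vector_space_axioms by blast
qed

lemma prod_scale_Pair:
  assumes "vector_space s1" "vector_space s2"
  shows "module_prod.scale s1 s2 c (x, y) = (s1 c x, s2 c y)"
proof -
  interpret vector_space_prod s1 s2
    using assms by (simp add: vector_space_prod_def vector_space_pair_def)
  show ?thesis by (rule scale_prod)
qed

text \<open>Flattens the nested linearity predicates into equations, so that bilinearity of a
  concrete map can be proved by simplification.\<close>

lemma bilinear_map_iff:
  "bilinear_map s1 s2 s3 f \<longleftrightarrow> vector_space s1 \<and> vector_space s2 \<and> vector_space s3
     \<and> (\<forall>x x' y. f (x + x') y = f x y + f x' y) \<and> (\<forall>c x y. f (s1 c x) y = s3 c (f x y))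
     \<and> (\<forall>x y y'. f x (y + y') = f x y + f x y') \<and> (\<forall>c x y. f x (s2 c y) = s3 c (f x y))"
  unfolding bilinear_map_def Vector_Spaces.linear_iff by auto

context bilinear_map
begin

lemma add_left: "f (x + x') y = f x y + f x' y"
  and add_right: "f x (y + y') = f x y + f x y'"
  and scale_left: "f (s1 c x) y = s3 c (f x y)"
  and scale_right: "f x (s2 c y) = s3 c (f x y)"
  using bilinear_map_axioms unfolding bilinear_map_iff by auto

lemma zero_left: "f 0 y = 0"
  using add_left[of 0 0 y] by simp

lemma zero_right: "f x 0 = 0"
  using add_right[of x 0 0] by simp

lemma minus_left: "f (- x) y = - f x y"
  using add_left[of x "- x" y] by (simp add: zero_left add_eq_0_iff)

lemma minus_right: "f x (- y) = - f x y"
  using add_right[of x y "- y"] by (simp add: zero_right add_eq_0_iff)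

lemma diff_left: "f (x - x') y = f x y - f x' y"
  using add_left[of x "- x'" y] by (simp add: minus_left)

lemma diff_right: "f x (y - y') = f x y - f x y'"
  using add_right[of x y "- y'"] by (simp add: minus_right)

text \<open>The zero rules matter when an identity on a direct sum is evaluated at pairs with a zero
  component: they erase all terms in which that component is an argument.\<close>

lemmas bilinear_simps = add_left add_right minus_left minus_right diff_left diff_right
  zero_left zero_right

end

lemma linear_diff:
  assumes "Vector_Spaces.linear s1 s2 f"
  shows "f (x - y) = f x - f y"
proof -
  interpret Vector_Spaces.linear s1 s2 f by fact
  show ?thesis by (rule diff)
qed

section \<open>Leibniz brackets and averaging operators\<close>

context leibniz_algebra
begin

text \<open>The Leibniz identity says that left multiplication by \<open>br x y\<close> is the
  commutator of the left multiplications by \<open>x\<close> and \<open>y\<close>, and commutators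
  are antisymmetric.\<close>

lemma bracket_sym_left: "br (br x y) z + br (br y x) z = 0"
proof -
  have "br (br x y) z = br x (br y z) - br y (br x z)"
    and "br (br y x) z = br y (br x z) - br x (br y z)"
    using leibniz[of x y z] leibniz[of y x z] by (simp_all add: eq_diff_eq)
  then show ?thesis by simp
qed

end

context averaging_pre_lie_algebra
begin

lemma bilinear_induced_bracket: "bilinear_map s s s (induced_bracket (\<circ>\<^sub>\<bullet>) P)"
proof -
  interpret m: bilinear_map s s s "(\<circ>\<^sub>\<bullet>)" by (rule bilinear)
  interpret vector_space s by (rule finite_dim_vector_space[OF finite_dim])
  interpret P: Vector_Spaces.linear s s P by (rule linear_P)
  show ?thesis
    unfolding bilinear_map_iff induced_bracket_def
    by (simp add: vector_space_axioms m.bilinear_simps m.scale_left m.scale_right P.add P.scale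
        scale_right_diff_distrib algebra_simps)
qed

text \<open>Averaging makes \<open>P\<close> send the induced bracket to the commutator of
  \<open>P x\<close> and \<open>P y\<close>. What remains is a combination of three pre-Lie
  identities, in which the third element \<open>z\<close> occupies the last position once and the
  middle position twice.\<close>

lemma leibniz_algebra_induced: "leibniz_algebra s (induced_bracket (\<circ>\<^sub>\<bullet>) P)"
proof (intro leibniz_algebra.intro)
  show "finite_dim s" by (rule finite_dim)
  show "bilinear_map s s s (induced_bracket (\<circ>\<^sub>\<bullet>) P)" by (rule bilinear_induced_bracket)
  fix x y z
  interpret m: bilinear_map s s s "(\<circ>\<^sub>\<bullet>)" by (rule bilinear)
  have P: "P (P x \<circ>\<^sub>\<bullet> y - y \<circ>\<^sub>\<bullet> P x) = P x \<circ>\<^sub>\<bullet> P y - P y \<circ>\<^sub>\<bullet> P x"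
    by (simp add: linear_diff[OF linear_P] averaging_left[symmetric] averaging_right[symmetric])
  \<comment> \<open>The pre-Lie identity is symmetric in its first two arguments and would loop as a
    general rewrite rule. Each instance is therefore fixed and solved for one term.\<close>
  have 1: "(P x \<circ>\<^sub>\<bullet> P y) \<circ>\<^sub>\<bullet> z = (P y \<circ>\<^sub>\<bullet> P x) \<circ>\<^sub>\<bullet> z - P y \<circ>\<^sub>\<bullet> (P x \<circ>\<^sub>\<bullet> z) + P x \<circ>\<^sub>\<bullet> (P y \<circ>\<^sub>\<bullet> z)"
    using pre_lie[of "P x" "P y" z] by (simp add: diff_eq_eq)
  have 2: "(P x \<circ>\<^sub>\<bullet> z) \<circ>\<^sub>\<bullet> P y = (z \<circ>\<^sub>\<bullet> P x) \<circ>\<^sub>\<bullet> P y - z \<circ>\<^sub>\<bullet> (P x \<circ>\<^sub>\<bullet> P y) + P x \<circ>\<^sub>\<bullet> (z \<circ>\<^sub>\<bullet> P y)"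
    using pre_lie[of "P x" z "P y"] by (simp add: diff_eq_eq)
  have 3: "(P y \<circ>\<^sub>\<bullet> z) \<circ>\<^sub>\<bullet> P x = (z \<circ>\<^sub>\<bullet> P y) \<circ>\<^sub>\<bullet> P x - z \<circ>\<^sub>\<bullet> (P y \<circ>\<^sub>\<bullet> P x) + P y \<circ>\<^sub>\<bullet> (z \<circ>\<^sub>\<bullet> P x)"
    using pre_lie[of "P y" z "P x"] by (simp add: diff_eq_eq)
  show "induced_bracket (\<circ>\<^sub>\<bullet>) P (induced_bracket (\<circ>\<^sub>\<bullet>) P x y) z
      + induced_bracket (\<circ>\<^sub>\<bullet>) P y (induced_bracket (\<circ>\<^sub>\<bullet>) P x z)
      = induced_bracket (\<circ>\<^sub>\<bullet>) P x (induced_bracket (\<circ>\<^sub>\<bullet>) P y z)"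
    unfolding induced_bracket_def P by (simp add: m.bilinear_simps 1 2 3)
qed

end

section \<open>The bicrossed averaging pre-Lie algebra\<close>

context averaging_pre_lie_matched_pair
begin

lemma averaging_pre_lie_algebra_bicrossed:
  "averaging_pre_lie_algebra (module_prod.scale sA sB)
     (pre_lie_bicrossed (\<circ>\<^sub>A) (\<circ>\<^sub>B) \<rho>A \<phi>A \<rho>B \<phi>B) (map_prod PA PB)"
proof (intro averaging_pre_lie_algebra.intro pre_lie_algebra.intro
    averaging_pre_lie_algebra_axioms.intro)
  interpret mA: bilinear_map sA sA sA "(\<circ>\<^sub>A)" by (rule A.bilinear)
  interpret mB: bilinear_map sB sB sB "(\<circ>\<^sub>B)" by (rule B.bilinear)
  interpret rA: bilinear_map sA sB sB \<rho>A by (rule rep_A.bilinear_rho)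
  interpret fA: bilinear_map sA sB sB \<phi>A by (rule rep_A.bilinear_phi)
  interpret rB: bilinear_map sB sA sA \<rho>B by (rule rep_B.bilinear_rho)
  interpret fB: bilinear_map sB sA sA \<phi>B by (rule rep_B.bilinear_phi)
  interpret vA: vector_space sA by (rule finite_dim_vector_space[OF A.finite_dim])
  interpret vB: vector_space sB by (rule finite_dim_vector_space[OF B.finite_dim])
  interpret PA: Vector_Spaces.linear sA sA PA by (rule A.linear_P)
  interpret PB: Vector_Spaces.linear sB sB PB by (rule B.linear_P)
  note bilin = mA.bilinear_simps mB.bilinear_simps rA.bilinear_simps fA.bilinear_simps
    rB.bilinear_simps fB.bilinear_simps
  note bilin_scale = mA.scale_left mA.scale_right mB.scale_left mB.scale_right
    rA.scale_left rA.scale_right fA.scale_left fA.scale_right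
    rB.scale_left rB.scale_right fB.scale_left fB.scale_right
  note scale_Pair = prod_scale_Pair[OF vA.vector_space_axioms vB.vector_space_axioms]
  let ?s = "module_prod.scale sA sB"
  let ?m = "pre_lie_bicrossed (\<circ>\<^sub>A) (\<circ>\<^sub>B) \<rho>A \<phi>A \<rho>B \<phi>B"
  show fd: "finite_dim ?s" by (rule finite_dim_prod[OF A.finite_dim B.finite_dim])
  note vs = finite_dim_vector_space[OF fd]
  show "bilinear_map ?s ?s ?s ?m"
    unfolding bilinear_map_iff pre_lie_bicrossed_def
    by (auto simp: vs scale_Pair bilin bilin_scale vA.scale_right_distrib vB.scale_right_distrib
        algebra_simps)
  show "Vector_Spaces.linear ?s ?s (map_prod PA PB)"
    unfolding Vector_Spaces.linear_iff
    by (auto simp: vs scale_Pair PA.add PB.add PA.scale PB.scale)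
  fix u v w :: "'a \<times> 'b"
  obtain x a y b z c where uvw: "u = (x, a)" "v = (y, b)" "w = (z, c)"
    by (metis surj_pair)
  \<comment> \<open>The identities that exchange two arguments are again fixed at one instance and
    solved for one term. In contrast, \<open>phi_mult\<close>, \<open>compat_rhoA\<close> and
    \<open>compat_rhoB\<close> have no such symmetry and serve below as general rewrite
    rules.\<close>
  have pre_lie_A: "(x \<circ>\<^sub>A y) \<circ>\<^sub>A z = (y \<circ>\<^sub>A x) \<circ>\<^sub>A z - y \<circ>\<^sub>A (x \<circ>\<^sub>A z) + x \<circ>\<^sub>A (y \<circ>\<^sub>A z)"
    using A.pre_lie[of x y z] by (simp add: diff_eq_eq)
  have pre_lie_B: "(a \<circ>\<^sub>B b) \<circ>\<^sub>B c = (b \<circ>\<^sub>B a) \<circ>\<^sub>B c - b \<circ>\<^sub>B (a \<circ>\<^sub>B c) + a \<circ>\<^sub>B (b \<circ>\<^sub>B c)"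
    using B.pre_lie[of a b c] by (simp add: diff_eq_eq)
  have rho_A: "\<rho>A (x \<circ>\<^sub>A y) c = \<rho>A x (\<rho>A y c) - \<rho>A y (\<rho>A x c) + \<rho>A (y \<circ>\<^sub>A x) c"
    using rep_A.rho_commutator[of x y c] by (simp add: bilin diff_eq_eq)
  have rho_B: "\<rho>B (a \<circ>\<^sub>B b) z = \<rho>B a (\<rho>B b z) - \<rho>B b (\<rho>B a z) + \<rho>B (b \<circ>\<^sub>B a) z"
    using rep_B.rho_commutator[of a b z] by (simp add: bilin diff_eq_eq)
  have phi_A: "\<phi>A z (a \<circ>\<^sub>B b) = \<phi>A (\<rho>B b z) a - \<phi>A (\<rho>B a z) b + a \<circ>\<^sub>B \<phi>A z b - b \<circ>\<^sub>B \<phi>A z a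
      + \<phi>A z (b \<circ>\<^sub>B a)"
    using compat_phiA[of z a b] by (simp add: bilin diff_eq_eq)
  have phi_B: "\<phi>B c (x \<circ>\<^sub>A y) = \<phi>B (\<rho>A y c) x - \<phi>B (\<rho>A x c) y + x \<circ>\<^sub>A \<phi>B c y - y \<circ>\<^sub>A \<phi>B c x
      + \<phi>B c (y \<circ>\<^sub>A x)"
    using compat_phiB[of c x y] by (simp add: bilin diff_eq_eq)
  \<comment> \<open>Facts \<open>1\<close> and \<open>2\<close> are the two components of the
    pre-Lie identity on the direct sum. Each expands into the pre-Lie identity of its own summand,
    the representation axioms on that summand and the compatibility conditions with values in
    it.\<close>
  have 1: "(x \<circ>\<^sub>A y + \<rho>B a y + \<phi>B b x) \<circ>\<^sub>A z + \<rho>B (a \<circ>\<^sub>B b + \<rho>A x b + \<phi>A y a) z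
        + \<phi>B c (x \<circ>\<^sub>A y + \<rho>B a y + \<phi>B b x)
      - (x \<circ>\<^sub>A (y \<circ>\<^sub>A z + \<rho>B b z + \<phi>B c y) + \<rho>B a (y \<circ>\<^sub>A z + \<rho>B b z + \<phi>B c y)
        + \<phi>B (b \<circ>\<^sub>B c + \<rho>A y c + \<phi>A z b) x)
      = (y \<circ>\<^sub>A x + \<rho>B b x + \<phi>B a y) \<circ>\<^sub>A z + \<rho>B (b \<circ>\<^sub>B a + \<rho>A y a + \<phi>A x b) z
        + \<phi>B c (y \<circ>\<^sub>A x + \<rho>B b x + \<phi>B a y)
      - (y \<circ>\<^sub>A (x \<circ>\<^sub>A z + \<rho>B a z + \<phi>B c x) + \<rho>B b (x \<circ>\<^sub>A z + \<rho>B a z + \<phi>B c x)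
        + \<phi>B (a \<circ>\<^sub>B c + \<rho>A x c + \<phi>A z a) y)"
    by (simp add: bilin pre_lie_A rho_B phi_B compat_rhoB rep_B.phi_mult)
  have 2: "(a \<circ>\<^sub>B b + \<rho>A x b + \<phi>A y a) \<circ>\<^sub>B c + \<rho>A (x \<circ>\<^sub>A y + \<rho>B a y + \<phi>B b x) c
        + \<phi>A z (a \<circ>\<^sub>B b + \<rho>A x b + \<phi>A y a)
      - (a \<circ>\<^sub>B (b \<circ>\<^sub>B c + \<rho>A y c + \<phi>A z b) + \<rho>A x (b \<circ>\<^sub>B c + \<rho>A y c + \<phi>A z b)
        + \<phi>A (y \<circ>\<^sub>A z + \<rho>B b z + \<phi>B c y) a)
      = (b \<circ>\<^sub>B a + \<rho>A y a + \<phi>A x b) \<circ>\<^sub>B c + \<rho>A (y \<circ>\<^sub>A x + \<rho>B b x + \<phi>B a y) c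
        + \<phi>A z (b \<circ>\<^sub>B a + \<rho>A y a + \<phi>A x b)
      - (b \<circ>\<^sub>B (a \<circ>\<^sub>B c + \<rho>A x c + \<phi>A z a) + \<rho>A y (a \<circ>\<^sub>B c + \<rho>A x c + \<phi>A z a)
        + \<phi>A (x \<circ>\<^sub>A z + \<rho>B a z + \<phi>B c x) b)"
    by (simp add: bilin pre_lie_B rho_A phi_A compat_rhoA rep_A.phi_mult)
  show "?m (?m u v) w - ?m u (?m v w) = ?m (?m v u) w - ?m v (?m u w)"
    using 1 2 by (simp add: uvw pre_lie_bicrossed_def)
  \<comment> \<open>In the product, \<phi> acts on the left factor by the right factor. Hence left
    averaging needs \<open>phi_averaging_right\<close>, and right averaging needs
    \<open>phi_averaging_left\<close>, whereas \<rho> keeps the sides.\<close>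
  show "?m (map_prod PA PB u) (map_prod PA PB v) = map_prod PA PB (?m (map_prod PA PB u) v)"
    by (simp add: uvw pre_lie_bicrossed_def PA.add PB.add
        A.averaging_left B.averaging_left rep_A.rho_averaging_left rep_B.rho_averaging_left
        rep_A.phi_averaging_right rep_B.phi_averaging_right)
  show "?m (map_prod PA PB u) (map_prod PA PB v) = map_prod PA PB (?m u (map_prod PA PB v))"
    by (simp add: uvw pre_lie_bicrossed_def PA.add PB.add
        A.averaging_right B.averaging_right rep_A.rho_averaging_right rep_B.rho_averaging_right
        rep_A.phi_averaging_left rep_B.phi_averaging_left)
qed

end

section \<open>Matched pairs from Leibniz brackets on a direct sum\<close>

text \<open>On triples whose entries each lie in one summand, bilinearity leaves few terms, and
  comparing components separates representation axioms from compatibility conditions. This avoids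
  verifying the axioms one by one for the concrete actions.\<close>

lemma leibniz_matched_pair_if_bicrossed:
  fixes sG :: "'k::field_char_0 \<Rightarrow> 'g::ab_group_add \<Rightarrow> 'g" and sH :: "'k \<Rightarrow> 'h::ab_group_add \<Rightarrow> 'h"
  assumes G: "leibniz_algebra sG brG"
    and H: "leibniz_algebra sH brH"
    and \<rho>L: "bilinear_map sG sH sH \<rho>L"
    and \<rho>R: "bilinear_map sG sH sH \<rho>R"
    and \<mu>L: "bilinear_map sH sG sG \<mu>L"
    and \<mu>R: "bilinear_map sH sG sG \<mu>R"
    and bicrossed: "leibniz_algebra s (leibniz_bicrossed brG brH \<rho>L \<rho>R \<mu>L \<mu>R)"
  shows "leibniz_matched_pair sG brG sH brH \<rho>L \<rho>R \<mu>L \<mu>R"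
proof -
  interpret G: leibniz_algebra sG brG by fact
  interpret H: leibniz_algebra sH brH by fact
  interpret bG: bilinear_map sG sG sG brG by (rule G.bilinear)
  interpret bH: bilinear_map sH sH sH brH by (rule H.bilinear)
  interpret rL: bilinear_map sG sH sH \<rho>L by fact
  interpret rR: bilinear_map sG sH sH \<rho>R by fact
  interpret mL: bilinear_map sH sG sG \<mu>L by fact
  interpret mR: bilinear_map sH sG sG \<mu>R by fact
  interpret D: leibniz_algebra s "leibniz_bicrossed brG brH \<rho>L \<rho>R \<mu>L \<mu>R" by fact
  note expand = leibniz_bicrossed_def bG.bilinear_simps bH.bilinear_simps rL.bilinear_simps
    rR.bilinear_simps mL.bilinear_simps mR.bilinear_simps
  show ?thesis
  proof
    fix x y :: 'g and \<xi> \<eta> :: 'h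
    \<comment> \<open>The letters record the summand of each entry. A triple with two entries from
      one summand yields a representation axiom in the component of the other summand and a
      compatibility condition in the component of the repeated one.\<close>
    note GGH = D.leibniz[of "(x, 0)" "(y, 0)" "(0, \<xi>)"]
    note GHG = D.leibniz[of "(x, 0)" "(0, \<xi>)" "(y, 0)"]
    note GHH = D.leibniz[of "(x, 0)" "(0, \<xi>)" "(0, \<eta>)"]
    note HHG = D.leibniz[of "(0, \<xi>)" "(0, \<eta>)" "(x, 0)"]
    note HGH = D.leibniz[of "(0, \<xi>)" "(x, 0)" "(0, \<eta>)"]
    note HGG = D.leibniz[of "(0, \<xi>)" "(x, 0)" "(y, 0)"]
    \<comment> \<open>The axioms \<open>R_L\<close>, \<open>compat_G3\<close> and
      \<open>compat_H3\<close> add the contributions of both orders of a mixed bracket, so they are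
      read off from \<open>bracket_sym_left\<close>; \<open>zero_prod_def\<close> then splits its
      zero into components.\<close>
    note sym_G = D.bracket_sym_left[of "(x, 0)" "(0, \<xi>)" "(y, 0)"]
    note sym_H = D.bracket_sym_left[of "(x, 0)" "(0, \<xi>)" "(0, \<eta>)"]
    show "finite_dim sH" by (rule H.finite_dim)
    show "finite_dim sG" by (rule G.finite_dim)
    show "\<rho>L (brG x y) \<xi> = \<rho>L x (\<rho>L y \<xi>) - \<rho>L y (\<rho>L x \<xi>)"
      using GGH by (simp add: expand algebra_simps)
    show "\<rho>R (brG x y) \<xi> = \<rho>L x (\<rho>R y \<xi>) - \<rho>R y (\<rho>L x \<xi>)"
      using GHG by (simp add: expand algebra_simps)
    show "\<rho>R y (\<rho>L x \<xi>) = - \<rho>R y (\<rho>R x \<xi>)"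
      using sym_G by (simp add: expand zero_prod_def eq_neg_iff_add_eq_0)
    show "\<mu>L (brH \<xi> \<eta>) x = \<mu>L \<xi> (\<mu>L \<eta> x) - \<mu>L \<eta> (\<mu>L \<xi> x)"
      using HHG by (simp add: expand algebra_simps)
    show "\<mu>R (brH \<xi> \<eta>) x = \<mu>L \<xi> (\<mu>R \<eta> x) - \<mu>R \<eta> (\<mu>L \<xi> x)"
      using HGH by (simp add: expand algebra_simps)
    show "\<mu>R \<eta> (\<mu>L \<xi> x) = - \<mu>R \<eta> (\<mu>R \<xi> x)"
      using sym_H by (simp add: expand zero_prod_def eq_neg_iff_add_eq_0 add.commute)
    show "\<rho>R x (brH \<xi> \<eta>) - brH \<xi> (\<rho>R x \<eta>) + brH \<eta> (\<rho>R x \<xi>)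
        - \<rho>R (\<mu>L \<eta> x) \<xi> + \<rho>R (\<mu>L \<xi> x) \<eta> = 0"
      using HHG by (simp add: expand algebra_simps)
    show "\<rho>L x (brH \<xi> \<eta>) - brH (\<rho>L x \<xi>) \<eta> - brH \<xi> (\<rho>L x \<eta>)
        - \<rho>L (\<mu>R \<xi> x) \<eta> - \<rho>R (\<mu>R \<eta> x) \<xi> = 0"
      using GHH by (simp add: expand algebra_simps)
    show "brH (\<rho>L x \<xi>) \<eta> + \<rho>L (\<mu>R \<xi> x) \<eta> + brH (\<rho>R x \<xi>) \<eta> + \<rho>L (\<mu>L \<xi> x) \<eta> = 0"
      using sym_H by (simp add: expand zero_prod_def algebra_simps)
    show "\<mu>R \<xi> (brG x y) - brG x (\<mu>R \<xi> y) + brG y (\<mu>R \<xi> x)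
        - \<mu>R (\<rho>L y \<xi>) x + \<mu>R (\<rho>L x \<xi>) y = 0"
      using GGH by (simp add: expand algebra_simps)
    show "\<mu>L \<xi> (brG x y) - brG (\<mu>L \<xi> x) y - brG x (\<mu>L \<xi> y)
        - \<mu>L (\<rho>R x \<xi>) y - \<mu>R (\<rho>R y \<xi>) x = 0"
      using HGG by (simp add: expand algebra_simps)
    show "brG (\<mu>L \<xi> x) y + \<mu>L (\<rho>R x \<xi>) y + brG (\<mu>R \<xi> x) y + \<mu>L (\<rho>L x \<xi>) y = 0"
      using sym_G by (simp add: expand zero_prod_def algebra_simps)
  qed
qed

section \<open>The induced bracket of the bicrossed algebra as a bicrossed bracket\<close>

theorem theorem2p24:
  fixes sA :: "'k::field_char_0 \<Rightarrow> 'a::ab_group_add \<Rightarrow> 'a"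
    and multA :: "'a \<Rightarrow> 'a \<Rightarrow> 'a"
    and PA :: "'a \<Rightarrow> 'a"
    and sB :: "'k \<Rightarrow> 'b::ab_group_add \<Rightarrow> 'b"
    and multB :: "'b \<Rightarrow> 'b \<Rightarrow> 'b"
    and PB :: "'b \<Rightarrow> 'b"
    and \<rho>A \<phi>A \<rho>L \<rho>R :: "'a \<Rightarrow> 'b \<Rightarrow> 'b"
    and \<rho>B \<phi>B \<mu>L \<mu>R :: "'b \<Rightarrow> 'a \<Rightarrow> 'a"
  assumes matched_pair:
      "averaging_pre_lie_matched_pair sA multA PA sB multB PB \<rho>A \<phi>A \<rho>B \<phi>B"
    and \<rho>L: "\<And>x \<xi>. \<rho>L x \<xi> = \<rho>A (PA x) \<xi> - \<phi>A (PA x) \<xi>"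
    and \<rho>R: "\<And>x \<xi>. \<rho>R x \<xi> = - \<rho>A x (PB \<xi>) + \<phi>A x (PB \<xi>)"
    and \<mu>L: "\<And>\<xi> x. \<mu>L \<xi> x = \<rho>B (PB \<xi>) x - \<phi>B (PB \<xi>) x"
    and \<mu>R: "\<And>\<xi> x. \<mu>R \<xi> x = - \<rho>B \<xi> (PA x) + \<phi>B \<xi> (PA x)"
  shows "leibniz_matched_pair sA (induced_bracket multA PA) sB (induced_bracket multB PB)
           \<rho>L \<rho>R \<mu>L \<mu>R
    \<and> leibniz_algebra (module_prod.scale sA sB)
           (leibniz_bicrossed (induced_bracket multA PA) (induced_bracket multB PB) \<rho>L \<rho>R \<mu>L \<mu>R)
    \<and> leibniz_algebra (module_prod.scale sA sB)
           (induced_bracket (pre_lie_bicrossed multA multB \<rho>A \<phi>A \<rho>B \<phi>B) (map_prod PA PB))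
    \<and> leibniz_bicrossed (induced_bracket multA PA) (induced_bracket multB PB) \<rho>L \<rho>R \<mu>L \<mu>R =
         induced_bracket (pre_lie_bicrossed multA multB \<rho>A \<phi>A \<rho>B \<phi>B) (map_prod PA PB)"
proof -
  interpret averaging_pre_lie_matched_pair sA multA PA sB multB PB \<rho>A \<phi>A \<rho>B \<phi>B
    by (rule matched_pair)
  interpret rA: bilinear_map sA sB sB \<rho>A by (rule rep_A.bilinear_rho)
  interpret fA: bilinear_map sA sB sB \<phi>A by (rule rep_A.bilinear_phi)
  interpret rB: bilinear_map sB sA sA \<rho>B by (rule rep_B.bilinear_rho)
  interpret fB: bilinear_map sB sA sA \<phi>B by (rule rep_B.bilinear_phi)
  interpret vA: vector_space sA by (rule finite_dim_vector_space[OF A.finite_dim])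
  interpret vB: vector_space sB by (rule finite_dim_vector_space[OF B.finite_dim])
  interpret PA: Vector_Spaces.linear sA sA PA by (rule A.linear_P)
  interpret PB: Vector_Spaces.linear sB sB PB by (rule B.linear_P)
  note bilin = bilinear_map_iff vA.vector_space_axioms vB.vector_space_axioms
    rA.bilinear_simps fA.bilinear_simps rB.bilinear_simps fB.bilinear_simps
    rA.scale_left rA.scale_right fA.scale_left fA.scale_right
    rB.scale_left rB.scale_right fB.scale_left fB.scale_right
    PA.add PA.scale PB.add PB.scale
    vA.scale_right_distrib vA.scale_right_diff_distrib vA.scale_minus_right
    vB.scale_right_distrib vB.scale_right_diff_distrib vB.scale_minus_right
  have bilinear: "bilinear_map sA sB sB \<rho>L" "bilinear_map sA sB sB \<rho>R"
    "bilinear_map sB sA sA \<mu>L" "bilinear_map sB sA sA \<mu>R"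
    by (simp_all add: bilin \<rho>L \<rho>R \<mu>L \<mu>R algebra_simps)
  \<comment> \<open>Among the mixed terms of the commutator, those whose acting element carries the
    averaging operator form \<rho>L and \<mu>L. Those whose acted-on element carries it form \<rho>R
    and \<mu>R.\<close>
  have eq: "leibniz_bicrossed (induced_bracket multA PA) (induced_bracket multB PB) \<rho>L \<rho>R \<mu>L \<mu>R =
      induced_bracket (pre_lie_bicrossed multA multB \<rho>A \<phi>A \<rho>B \<phi>B) (map_prod PA PB)"
    by (auto simp: fun_eq_iff leibniz_bicrossed_def pre_lie_bicrossed_def induced_bracket_def
        \<rho>L \<rho>R \<mu>L \<mu>R)
  \<comment> \<open>The Leibniz identity is first obtained on the pre-Lie side and carried over by
    \<open>eq\<close>; the matched pair is deduced from it afterwards, which reverses the usual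
    order.\<close>
  note induced = averaging_pre_lie_algebra.leibniz_algebra_induced[OF averaging_pre_lie_algebra_bicrossed]
  then have bicrossed: "leibniz_algebra (module_prod.scale sA sB)
      (leibniz_bicrossed (induced_bracket multA PA) (induced_bracket multB PB) \<rho>L \<rho>R \<mu>L \<mu>R)"
    unfolding eq .
  show ?thesis
    using leibniz_matched_pair_if_bicrossed[OF A.leibniz_algebra_induced B.leibniz_algebra_induced
        bilinear bicrossed] bicrossed induced eq by blast
qed

end
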